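(* The smooth affine variety $(\mathbb{C}^* )^{2n}$, with coordinates $(z_1,\dots,z_n,w_1,\dots,w_n)$, equipped with the algebraic symplectic form $\sum_{j=1}^n\frac{dz_j}{z_j}\wedge\frac{dw_j}{w_j}$ has the algebraic symplectic density property.
   Context: Here $n\ge1$ is an integer. For a smooth affine complex variety $X$ with an algebraic symplectic form $\omega$ (closed, nowhere degenerate algebraic $2$-form), an algebraic vector field $V$ is symplectic if the $1$-form $i_V\omega$ is closed. A vector field is complete if its flow exists for all complex times from every initial point. $(X,\omega)$ has the algebraic symplectic density property if the Lie algebra (under the commutator) generated by the complete algebraic symplectic vector fields on $X$ equals the Lie algebra of all algebraic symplectic vector fields on $X$. *)

theory Defs
  imports "HOL-Analysis.Analysis"
begin

text \<open>
  The affine varieties considered are the principal open subsets of affine space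
  \<open>\<complex>\<^sup>m\<close>, where \<open>m = CARD('m)\<close>: the set of points where a polynomial \<open>g\<close> does not vanish.
  The coordinate ring of such a variety is the localisation of the polynomial ring at \<open>g\<close>,
  and its tangent bundle is trivialised by the ambient coordinates.
\<close>

inductive polynomial_fun :: "(complex ^ 'm::finite \<Rightarrow> complex) \<Rightarrow> bool" where
  const: "polynomial_fun (\<lambda>x. c)"
| coord: "polynomial_fun (\<lambda>x. x $ i)"
| add: "polynomial_fun p \<Longrightarrow> polynomial_fun q \<Longrightarrow> polynomial_fun (\<lambda>x. p x + q x)"
| mult: "polynomial_fun p \<Longrightarrow> polynomial_fun q \<Longrightarrow> polynomial_fun (\<lambda>x. p x * q x)"

definition principal_open :: "(complex ^ 'm::finite \<Rightarrow> complex) \<Rightarrow> (complex ^ 'm) set" where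
  "principal_open g = {x. g x \<noteq> 0}"

definition regular_fun ::
    "(complex ^ 'm::finite \<Rightarrow> complex) \<Rightarrow> (complex ^ 'm \<Rightarrow> complex) \<Rightarrow> bool" where
  "regular_fun g f \<longleftrightarrow>
     (\<exists>p k. polynomial_fun p \<and> (\<forall>x \<in> principal_open g. f x = p x / g x ^ k))"

definition dir_deriv ::
    "(complex ^ 'm::finite \<Rightarrow> complex) \<Rightarrow> complex ^ 'm \<Rightarrow> complex ^ 'm \<Rightarrow> complex" where
  "dir_deriv f x u = deriv (\<lambda>t. f (x + t *s u)) 0"


subsection \<open>Differential forms\<close>

text \<open>
  A form takes the base point as first argument and then its tangent vectors. The tangent
  vectors in the formulas for the exterior derivative are extended to constant vector fields,
  which commute, so no bracket terms occur.
\<close>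

type_synonym 'm form1 = "complex ^ 'm \<Rightarrow> complex ^ 'm \<Rightarrow> complex"
type_synonym 'm form2 = "complex ^ 'm \<Rightarrow> complex ^ 'm \<Rightarrow> complex ^ 'm \<Rightarrow> complex"

definition wedge :: "'m::finite form1 \<Rightarrow> 'm form1 \<Rightarrow> 'm form2"  (infixr "\<and>\<^sub>f" 70) where
  "(\<alpha> \<and>\<^sub>f \<beta>) x u v = \<alpha> x u * \<beta> x v - \<alpha> x v * \<beta> x u"

definition closed_form1 :: "(complex ^ 'm) set \<Rightarrow> 'm::finite form1 \<Rightarrow> bool" where
  "closed_form1 X \<alpha> \<longleftrightarrow>
     (\<forall>x \<in> X. \<forall>u v. dir_deriv (\<lambda>y. \<alpha> y v) x u - dir_deriv (\<lambda>y. \<alpha> y u) x v = 0)"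

definition closed_form2 :: "(complex ^ 'm) set \<Rightarrow> 'm::finite form2 \<Rightarrow> bool" where
  "closed_form2 X \<omega> \<longleftrightarrow>
     (\<forall>x \<in> X. \<forall>u v w. dir_deriv (\<lambda>y. \<omega> y v w) x u - dir_deriv (\<lambda>y. \<omega> y u w) x v
                       + dir_deriv (\<lambda>y. \<omega> y u v) x w = 0)"

definition algebraic_form2 :: "(complex ^ 'm::finite \<Rightarrow> complex) \<Rightarrow> 'm form2 \<Rightarrow> bool" where
  "algebraic_form2 g \<omega> \<longleftrightarrow>
     (\<forall>x \<in> principal_open g.
        (\<forall>u. Vector_Spaces.linear (*s) (*) (\<lambda>v. \<omega> x u v)) \<and>
        (\<forall>v. Vector_Spaces.linear (*s) (*) (\<lambda>u. \<omega> x u v)) \<and>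
        (\<forall>u. \<omega> x u u = 0)) \<and>
     (\<forall>u v. regular_fun g (\<lambda>x. \<omega> x u v))"

definition nondegenerate_form2 :: "(complex ^ 'm) set \<Rightarrow> 'm::finite form2 \<Rightarrow> bool" where
  "nondegenerate_form2 X \<omega> \<longleftrightarrow> (\<forall>x \<in> X. \<forall>u. (\<forall>v. \<omega> x u v = 0) \<longrightarrow> u = 0)"

definition algebraic_symplectic_form ::
    "(complex ^ 'm::finite \<Rightarrow> complex) \<Rightarrow> 'm form2 \<Rightarrow> bool" where
  "algebraic_symplectic_form g \<omega> \<longleftrightarrow>
     algebraic_form2 g \<omega> \<and> closed_form2 (principal_open g) \<omega> \<and>
     nondegenerate_form2 (principal_open g) \<omega>"


subsection \<open>Vector fields\<close>

type_synonym 'm vfield = "complex ^ 'm \<Rightarrow> complex ^ 'm"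

text \<open>
  A vector field on \<open>X\<close> is represented by the total function that is zero outside \<open>X\<close>, so that
  equality of functions is equality of vector fields on \<open>X\<close>.
\<close>

definition algebraic_vfield ::
    "(complex ^ 'm::finite \<Rightarrow> complex) \<Rightarrow> 'm vfield \<Rightarrow> bool" where
  "algebraic_vfield g V \<longleftrightarrow>
     (\<forall>i. regular_fun g (\<lambda>x. V x $ i)) \<and> (\<forall>x. x \<notin> principal_open g \<longrightarrow> V x = 0)"

definition contraction :: "'m::finite vfield \<Rightarrow> 'm form2 \<Rightarrow> 'm form1" where
  "contraction V \<omega> x v = \<omega> x (V x) v"

definition symplectic_vfield ::
    "(complex ^ 'm) set \<Rightarrow> 'm::finite form2 \<Rightarrow> 'm vfield \<Rightarrow> bool" where
  "symplectic_vfield X \<omega> V \<longleftrightarrow> closed_form1 X (contraction V \<omega>)"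

definition complete_vfield :: "(complex ^ 'm) set \<Rightarrow> 'm::finite vfield \<Rightarrow> bool" where
  "complete_vfield X V \<longleftrightarrow>
     (\<forall>x \<in> X. \<exists>\<phi> :: complex \<Rightarrow> complex ^ 'm. \<phi> 0 = x \<and>
        (\<forall>t. \<phi> t \<in> X \<and> (\<phi> has_derivative (\<lambda>h. h *s V (\<phi> t))) (at t)))"

definition lie_bracket ::
    "(complex ^ 'm) set \<Rightarrow> 'm::finite vfield \<Rightarrow> 'm vfield \<Rightarrow> 'm vfield" where
  "lie_bracket X V W x =
     (if x \<in> X
      then \<chi> i. dir_deriv (\<lambda>y. W y $ i) x (V x) - dir_deriv (\<lambda>y. V y $ i) x (W x)
      else 0)"

inductive_set generated_lie_algebra ::
    "(complex ^ 'm) set \<Rightarrow> 'm::finite vfield set \<Rightarrow> 'm vfield set"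
  for X :: "(complex ^ 'm) set" and S :: "'m vfield set" where
  generator: "V \<in> S \<Longrightarrow> V \<in> generated_lie_algebra X S"
| zero: "(\<lambda>x. 0) \<in> generated_lie_algebra X S"
| add: "V \<in> generated_lie_algebra X S \<Longrightarrow> W \<in> generated_lie_algebra X S
          \<Longrightarrow> (\<lambda>x. V x + W x) \<in> generated_lie_algebra X S"
| scale: "V \<in> generated_lie_algebra X S \<Longrightarrow> (\<lambda>x. c *s V x) \<in> generated_lie_algebra X S"
| bracket: "V \<in> generated_lie_algebra X S \<Longrightarrow> W \<in> generated_lie_algebra X S
          \<Longrightarrow> lie_bracket X V W \<in> generated_lie_algebra X S"

definition algebraic_symplectic_density_property ::
    "(complex ^ 'm::finite \<Rightarrow> complex) \<Rightarrow> 'm form2 \<Rightarrow> bool" where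
  "algebraic_symplectic_density_property g \<omega> \<longleftrightarrow>
     polynomial_fun g \<and> algebraic_symplectic_form g \<omega> \<and>
     generated_lie_algebra (principal_open g)
       {V. algebraic_vfield g V \<and> symplectic_vfield (principal_open g) \<omega> V \<and>
           complete_vfield (principal_open g) V}
     = {V. algebraic_vfield g V \<and> symplectic_vfield (principal_open g) \<omega> V}"


subsection \<open>The torus with its logarithmic form\<close>

text \<open>
  With \<open>n = CARD('n)\<close>, the coordinates on \<open>\<complex>\<^sup>2\<^sup>n\<close> are indexed by \<open>'n + 'n\<close>: the coordinate
  \<open>z\<^sub>j\<close> is \<open>x $ Inl j\<close> and \<open>w\<^sub>j\<close> is \<open>x $ Inr j\<close>.
\<close>

definition coord_prod :: "complex ^ 'm::finite \<Rightarrow> complex" where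
  "coord_prod x = (\<Prod>i\<in>UNIV. x $ i)"

lemma principal_open_coord_prod: "principal_open coord_prod = {x. \<forall>i. x $ i \<noteq> 0}"
  by (simp add: principal_open_def coord_prod_def)

definition dlog_coord :: "'m::finite \<Rightarrow> 'm form1" where
  "dlog_coord i x u = u $ i / x $ i"

definition log_symplectic_form :: "('n::finite + 'n) form2" where
  "log_symplectic_form x u v =
     (\<Sum>j\<in>UNIV. (dlog_coord (Inl j) \<and>\<^sub>f dlog_coord (Inr j)) x u v)"

end

theory Submission
  imports Defs
begin

text \<open>
  Write \<open>x\<^sup>a\<close> for the character of the torus with exponent vector \<open>a\<close>. Regular functions on the
  torus are Laurent polynomials, so every algebraic vector field is a finite sum of homogeneous
  fields \<open>x\<^sup>a \<cdot> (\<Sum>\<^sub>i c\<^sub>i x\<^sub>i \<partial>/\<partial>x\<^sub>i)\<close> of pairwise different weights \<open>a\<close>. In the frame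
  \<open>dx\<^sub>i / x\<^sub>i\<close> the form is constant, so contraction with it turns such a field into
  \<open>x\<^sup>a \<cdot> (\<Sum>\<^sub>k c'\<^sub>k dx\<^sub>k / x\<^sub>k)\<close>, where \<open>c'\<close> is a fixed linear image of \<open>c\<close>. The exterior
  derivative preserves weights, and characters are linearly independent; hence the sum is
  symplectic exactly if each summand is, and this means \<open>c' \<and> a = 0\<close>: the Hamiltonian is a
  multiple of \<open>x\<^sup>a\<close>, or \<open>a = 0\<close> (\<open>symplectic_char_sum_iff\<close>).

  By antisymmetry of the form, \<open>c' \<and> a = 0\<close> gives \<open>\<Sum>\<^sub>i a\<^sub>i c\<^sub>i = 0\<close>. Then \<open>x\<^sup>a\<close> is constant along the
  flow of the homogeneous field, which therefore moves each coordinate by the exponential factor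
  \<open>exp (t c\<^sub>i x\<^sup>a)\<close> and exists for all complex times (\<open>complete_char_field\<close>). So every algebraic
  symplectic field is a finite sum of complete ones, hence lies in the linear span of the
  generators.

  Conversely, the algebraic symplectic fields form a Lie algebra. By the decomposition it is enough
  to bracket homogeneous fields, and the bracket of weights \<open>a\<close> and \<open>b\<close> is homogeneous of weight
  \<open>a + b\<close> with explicit coefficients, for which the symplectic condition is a matter of linear
  algebra (\<open>symplectic_coeff_bracket\<close>).
\<close>

section \<open>Laurent polynomials as the regular functions on the torus\<close>

abbreviation torus :: "(complex ^ 'm::finite) set" where
  "torus \<equiv> principal_open coord_prod"

definition torus_char :: "('m \<Rightarrow> int) \<Rightarrow> complex ^ 'm::finite \<Rightarrow> complex" where
  "torus_char a x = (\<Prod>i\<in>UNIV. x $ i powi a i)"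

lemma torus_coord_nonzero: "x \<in> torus \<Longrightarrow> x $ i \<noteq> 0"
  by (simp add: principal_open_coord_prod)

lemma torus_char_nonzero: "x \<in> torus \<Longrightarrow> torus_char a x \<noteq> 0"
  by (simp add: torus_char_def torus_coord_nonzero power_int_eq_0_iff)

lemma torus_char_0: "torus_char (\<lambda>k. 0) x = 1"
  by (simp add: torus_char_def)

lemma torus_char_add:
  "x \<in> torus \<Longrightarrow> torus_char (\<lambda>k. a k + b k) x = torus_char a x * torus_char b x"
  by (simp add: torus_char_def torus_coord_nonzero power_int_add prod.distrib)

lemma torus_char_coord: "torus_char (\<lambda>k. of_bool (k = i)) x = x $ i"
proof -
  have "torus_char (\<lambda>k. of_bool (k = i)) x = (\<Prod>k\<in>UNIV. if k = i then x $ k else 1)"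
    unfolding torus_char_def by (intro prod.cong) auto
  then show ?thesis
    by simp
qed

lemma torus_char_inverse: "x \<in> torus \<Longrightarrow> torus_char (\<lambda>k. - a k) x = inverse (torus_char a x)"
  by (simp add: torus_char_def power_int_minus prod_inversef[unfolded o_def])

definition laurent :: "(complex ^ 'm::finite \<Rightarrow> complex) \<Rightarrow> bool" where
  "laurent f \<longleftrightarrow>
     (\<exists>S c. finite S \<and> (\<forall>x \<in> torus. f x = (\<Sum>a\<in>S. c a * torus_char a x)))"

lemma laurent_cong: "laurent f \<Longrightarrow> (\<And>x. x \<in> torus \<Longrightarrow> g x = f x) \<Longrightarrow> laurent g"
  unfolding laurent_def by simp

lemma laurent_char: "laurent (torus_char a)"
  unfolding laurent_def by (rule exI[of _ "{a}"], rule exI[of _ "\<lambda>_. 1"]) simp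

lemma laurent_scale: "laurent f \<Longrightarrow> laurent (\<lambda>x. c * f x)"
  unfolding laurent_def by (force simp: sum_distrib_left mult.assoc intro: exI[of _ "\<lambda>a. c * d a" for d])

lemma laurent_const: "laurent (\<lambda>x. c)"
  using laurent_scale[OF laurent_char[of "\<lambda>k. 0"], of c] by (simp add: torus_char_0)

lemma laurent_add:
  assumes "laurent f" "laurent g"
  shows "laurent (\<lambda>x. f x + g x)"
proof -
  from assms obtain S c T d
    where S: "finite S" "\<And>x. x \<in> torus \<Longrightarrow> f x = (\<Sum>a\<in>S. c a * torus_char a x)"
      and T: "finite T" "\<And>x. x \<in> torus \<Longrightarrow> g x = (\<Sum>a\<in>T. d a * torus_char a x)"
    unfolding laurent_def by meson
  let ?e = "\<lambda>a. (if a \<in> S then c a else 0) + (if a \<in> T then d a else 0)"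
  have "f x + g x = (\<Sum>a\<in>S \<union> T. ?e a * torus_char a x)" if "x \<in> torus" for x
  proof -
    have "(\<Sum>a\<in>S \<union> T. ?e a * torus_char a x) =
        (\<Sum>a\<in>S \<union> T. if a \<in> S then c a * torus_char a x else 0) +
        (\<Sum>a\<in>S \<union> T. if a \<in> T then d a * torus_char a x else 0)"
      unfolding sum.distrib[symmetric] by (intro sum.cong) (auto simp: distrib_right)
    then show ?thesis
      using S T that by (simp add: sum.If_cases Int_absorb1 Collect_mem_eq inf_commute Int_Un_distrib
            Un_Int_distrib)
  qed
  then show ?thesis
    unfolding laurent_def using S(1) T(1)
    by (intro exI[of _ "S \<union> T"] exI[of _ ?e]) simp
qed

lemma laurent_sum: "finite I \<Longrightarrow> (\<And>i. i \<in> I \<Longrightarrow> laurent (f i)) \<Longrightarrow> laurent (\<lambda>x. \<Sum>i\<in>I. f i x)"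
  by (induction I rule: finite_induct) (auto intro: laurent_add laurent_const)

lemma laurent_char_mult:
  assumes "laurent f"
  shows "laurent (\<lambda>x. torus_char b x * f x)"
proof -
  from assms obtain S c
    where S: "finite S" "\<And>x. x \<in> torus \<Longrightarrow> f x = (\<Sum>a\<in>S. c a * torus_char a x)"
    unfolding laurent_def by meson
  have "laurent (\<lambda>x. \<Sum>a\<in>S. c a * torus_char (\<lambda>k. b k + a k) x)"
    by (intro laurent_sum laurent_scale laurent_char S)
  then show ?thesis
    by (rule laurent_cong) (simp add: S torus_char_add sum_distrib_left mult_ac)
qed

lemma laurent_mult:
  assumes "laurent f" "laurent g"
  shows "laurent (\<lambda>x. f x * g x)"
proof -
  from assms(1) obtain S c
    where S: "finite S" "\<And>x. x \<in> torus \<Longrightarrow> f x = (\<Sum>a\<in>S. c a * torus_char a x)"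
    unfolding laurent_def by meson
  have "laurent (\<lambda>x. \<Sum>a\<in>S. c a * (torus_char a x * g x))"
    by (intro laurent_sum laurent_scale laurent_char_mult assms S)
  then show ?thesis
    by (rule laurent_cong) (simp add: S sum_distrib_right mult.assoc)
qed

lemma laurent_coord: "laurent (\<lambda>x. x $ i)"
  by (rule laurent_cong[OF laurent_char[of "\<lambda>k. of_bool (k = i)"]]) (simp add: torus_char_coord)

lemma laurent_coord_inverse: "laurent (\<lambda>x. inverse (x $ i))"
  by (rule laurent_cong[OF laurent_char[of "\<lambda>k. - of_bool (k = i)"]])
    (simp add: torus_char_inverse torus_char_coord)

lemma polynomial_imp_laurent: "polynomial_fun p \<Longrightarrow> laurent p"
  by (induction rule: polynomial_fun.induct)
    (auto intro: laurent_const laurent_coord laurent_add laurent_mult)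

lemma regular_imp_laurent:
  fixes f :: "complex ^ 'm::finite \<Rightarrow> complex"
  assumes "regular_fun coord_prod f"
  shows "laurent f"
proof -
  from assms obtain p k
    where p: "polynomial_fun p" "\<And>x. x \<in> torus \<Longrightarrow> f x = p x / coord_prod x ^ k"
    unfolding regular_fun_def by meson
  have "torus_char (\<lambda>i. - int k) x = inverse (coord_prod x ^ k)" for x :: "complex ^ 'm"
    by (simp add: torus_char_def coord_prod_def power_int_minus prod_inversef[unfolded o_def] prod_power_distrib)
  then show ?thesis
    using laurent_char_mult[OF polynomial_imp_laurent[OF p(1)], of "\<lambda>i. - int k"]
    by (elim laurent_cong) (simp add: p(2) field_simps)
qed

lemma polynomial_fun_prod:
  "finite I \<Longrightarrow> (\<And>i. i \<in> I \<Longrightarrow> polynomial_fun (f i)) \<Longrightarrow> polynomial_fun (\<lambda>x. \<Prod>i\<in>I. f i x)"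
  by (induction I rule: finite_induct) (auto intro: polynomial_fun.intros)

lemma polynomial_fun_power: "polynomial_fun p \<Longrightarrow> polynomial_fun (\<lambda>x. p x ^ k)"
  by (induction k) (auto intro: polynomial_fun.intros)

lemma polynomial_coord_prod: "polynomial_fun coord_prod"
  unfolding coord_prod_def[abs_def] by (intro polynomial_fun_prod polynomial_fun.coord) simp

text \<open>
  A large power of the product of all coordinates clears the negative exponents of a character
  and leaves a monomial.
\<close>

lemma regular_char:
  fixes a :: "'m::finite \<Rightarrow> int"
  shows "regular_fun coord_prod (torus_char a)"
proof -
  define N where "N = (\<Sum>i\<in>UNIV. nat \<bar>a i\<bar>)"
  have N: "0 \<le> a i + int N" for i
  proof -
    have "nat \<bar>a i\<bar> \<le> N"
      unfolding N_def by (rule member_le_sum) auto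
    then show ?thesis
      by linarith
  qed
  have "polynomial_fun (\<lambda>x::complex^'m. \<Prod>i\<in>UNIV. x $ i ^ nat (a i + int N))"
    by (intro polynomial_fun_prod polynomial_fun_power polynomial_fun.coord) simp
  moreover have "torus_char a x = (\<Prod>i\<in>UNIV. x $ i ^ nat (a i + int N)) / coord_prod x ^ N"
    if x: "x \<in> torus" for x
  proof -
    have "(\<Prod>i\<in>UNIV. x $ i ^ nat (a i + int N)) = torus_char (\<lambda>i. a i + int N) x"
      unfolding torus_char_def by (intro prod.cong) (simp_all add: power_int_nonneg_exp N)
    also have "\<dots> = torus_char a x * coord_prod x ^ N"
      using x by (simp add: torus_char_add) (simp add: torus_char_def coord_prod_def prod_power_distrib)
    finally show ?thesis
      using x by (simp add: principal_open_def)
  qed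
  ultimately show ?thesis
    unfolding regular_fun_def by blast
qed

lemma regular_add:
  assumes "polynomial_fun g" "regular_fun g f" "regular_fun g h"
  shows "regular_fun g (\<lambda>x. f x + h x)"
proof -
  from assms obtain p k q l
    where p: "polynomial_fun p" "\<And>x. x \<in> principal_open g \<Longrightarrow> f x = p x / g x ^ k"
      and q: "polynomial_fun q" "\<And>x. x \<in> principal_open g \<Longrightarrow> h x = q x / g x ^ l"
    unfolding regular_fun_def by meson
  have "polynomial_fun (\<lambda>x. p x * g x ^ l + q x * g x ^ k)"
    by (intro polynomial_fun.add polynomial_fun.mult polynomial_fun_power p q assms)
  moreover have "f x + h x = (p x * g x ^ l + q x * g x ^ k) / g x ^ (k + l)"
    if "x \<in> principal_open g" for x
    using that p(2) q(2) by (simp add: principal_open_def power_add field_simps)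
  ultimately show ?thesis
    unfolding regular_fun_def by blast
qed

lemma regular_scale:
  assumes "regular_fun g f"
  shows "regular_fun g (\<lambda>x. c * f x)"
proof -
  from assms obtain p k
    where p: "polynomial_fun p" "\<And>x. x \<in> principal_open g \<Longrightarrow> f x = p x / g x ^ k"
    unfolding regular_fun_def by meson
  then show ?thesis
    unfolding regular_fun_def
    by (intro exI[of _ "\<lambda>x. c * p x"] exI[of _ k]) (auto intro: polynomial_fun.intros)
qed

lemma regular_iff_laurent: "regular_fun coord_prod f \<longleftrightarrow> laurent f"
proof
  assume "laurent f"
  then obtain S c
    where S: "finite S" "\<And>x. x \<in> torus \<Longrightarrow> f x = (\<Sum>a\<in>S. c a * torus_char a x)"
    unfolding laurent_def by meson
  have "regular_fun coord_prod (\<lambda>x. 0 * torus_char (\<lambda>k. 0) x)"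
    by (intro regular_scale regular_char)
  then have zero: "regular_fun coord_prod (\<lambda>x. 0)"
    by simp
  from S(1) have "regular_fun coord_prod (\<lambda>x. \<Sum>a\<in>S. c a * torus_char a x)"
    by (induction S rule: finite_induct)
      (auto intro!: zero regular_add regular_scale regular_char polynomial_coord_prod)
  then show "regular_fun coord_prod f"
    unfolding regular_fun_def by (simp add: S(2))
qed (rule regular_imp_laurent)

text \<open>
  Doubling one coordinate acts on the characters with eigenvalues \<open>2\<^sup>k\<close>, where \<open>k\<close> is the exponent
  of that coordinate. Two different characters are told apart by some coordinate, so subtracting
  a multiple of a vanishing combination from its image under the doubling removes one of them while
  keeping the other, and induction on the number of characters applies.
\<close>

lemma torus_char_independent:
  assumes "finite S" "\<And>x. x \<in> torus \<Longrightarrow> (\<Sum>a\<in>S. c a * torus_char a x) = 0" "a \<in> S"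
  shows "c a = 0"
  using assms
proof (induction S arbitrary: c a rule: finite_induct)
  case (insert b S)
  have S: "c a = 0" if a: "a \<in> S" for a
  proof -
    obtain i where i: "a i \<noteq> b i"
      using insert.hyps a by (metis ext)
    have scaled: "torus_char e (\<chi> k. if k = i then 2 * x $ k else x $ k) = 2 powi e i * torus_char e x"
      for e and x :: "complex ^ 'a"
    proof -
      have "torus_char e (\<chi> k. if k = i then 2 * x $ k else x $ k) =
          (\<Prod>k\<in>UNIV. (if k = i then 2 powi e k else 1) * x $ k powi e k)"
        unfolding torus_char_def by (intro prod.cong) (auto simp: power_int_mult_distrib)
      then show ?thesis
        by (simp add: torus_char_def prod.distrib)
    qed
    have "(\<Sum>e\<in>S. c e * (2 powi e i - 2 powi b i) * torus_char e x) = 0" if x: "x \<in> torus" for x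
    proof -
      have "(\<chi> k. if k = i then 2 * x $ k else x $ k) \<in> torus"
        using x by (simp add: principal_open_coord_prod)
      then have "(\<Sum>e\<in>insert b S. c e * (2 powi e i * torus_char e x)) = 0"
        using insert.prems(1)[of "\<chi> k. if k = i then 2 * x $ k else x $ k"] by (simp only: scaled)
      moreover have "(\<Sum>e\<in>insert b S. c e * torus_char e x) = 0"
        using insert.prems(1) x by blast
      ultimately have "(\<Sum>e\<in>insert b S. c e * (2 powi e i * torus_char e x)) -
          2 powi b i * (\<Sum>e\<in>insert b S. c e * torus_char e x) = 0"
        by simp
      then show ?thesis
        using insert.hyps by (simp add: sum_distrib_left sum_subtractf algebra_simps)
    qed
    then have "c a * (2 powi a i - 2 powi b i) = 0"
      using insert.IH[of "\<lambda>e. c e * (2 powi e i - 2 powi b i)" a] a by blast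
    moreover have "(2::complex) powi a i \<noteq> 2 powi b i"
    proof
      assume "(2::complex) powi a i = 2 powi b i"
      then have "norm ((2::complex) powi a i) = norm ((2::complex) powi b i)"
        by simp
      then have "(2::real) powi a i = 2 powi b i"
        by (simp add: norm_power_int)
      then show False
        using i power_int_strict_increasing[of "a i" "b i" "2::real"]
          power_int_strict_increasing[of "b i" "a i" "2::real"]
        by (cases "a i" "b i" rule: linorder_cases) auto
    qed
    ultimately show ?thesis
      by simp
  qed
  have "(1 :: complex ^ 'a) \<in> torus"
    by (simp add: principal_open_coord_prod)
  then have "(\<Sum>e\<in>insert b S. c e * torus_char e 1) = 0"
    using insert.prems(1) by blast
  then have "c b * torus_char b 1 = 0"
    using insert.hyps S by simp
  then have "c b = 0"
    using torus_char_nonzero[OF \<open>1 \<in> torus\<close>] by simp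
  then show ?case
    using S insert.prems(2) by blast
qed simp

section \<open>Directional derivatives of Laurent polynomials\<close>

text \<open>
  The torus is open, so a directional derivative at one of its points sees only the values on the
  torus; there every regular function may be replaced by its Laurent expansion.
\<close>

lemma eventually_line_in_torus:
  assumes "x \<in> torus"
  shows "\<forall>\<^sub>F t in nhds 0. x + t *s u \<in> torus"
proof -
  have "\<forall>\<^sub>F t in nhds 0. x $ i + t * u $ i \<noteq> 0" for i
  proof -
    have "((\<lambda>t. x $ i + t * u $ i) \<longlongrightarrow> x $ i + 0 * u $ i) (nhds 0)"
      by (intro tendsto_intros filterlim_ident)
    then show ?thesis
      using torus_coord_nonzero[OF assms] by (intro tendsto_imp_eventually_ne) auto
  qed
  then show ?thesis
    by (simp add: principal_open_coord_prod eventually_all_finite)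
qed

lemma dir_deriv_cong:
  assumes "\<And>y. y \<in> torus \<Longrightarrow> f y = g y" "x \<in> torus"
  shows "dir_deriv f x u = dir_deriv g x u"
  unfolding dir_deriv_def
  using eventually_mono[OF eventually_line_in_torus[OF assms(2)] assms(1)]
  by (intro deriv_cong_ev) auto

lemma has_field_derivative_char_line:
  assumes x: "x \<in> torus"
  shows "((\<lambda>t. torus_char a (x + t *s u)) has_field_derivative
           torus_char a x * (\<Sum>i\<in>UNIV. of_int (a i) * (u $ i / x $ i))) (at 0)"
proof -
  have "((\<lambda>t. \<Prod>i\<in>I. (x $ i + t * u $ i) powi a i) has_field_derivative
           (\<Prod>i\<in>I. x $ i powi a i) * (\<Sum>i\<in>I. of_int (a i) * (u $ i / x $ i))) (at 0)"
    if "finite I" for I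
    using that
  proof (induction I rule: finite_induct)
    case (insert j I)
    have D: "((\<lambda>t. (x $ j + t * u $ j) powi a j) has_field_derivative
        of_int (a j) * x $ j powi (a j - 1) * u $ j) (at 0)"
      using torus_coord_nonzero[OF x] by (auto intro!: derivative_eq_intros)
    show ?case
      unfolding prod.insert[OF insert.hyps] sum.insert[OF insert.hyps]
      by (rule DERIV_cong[OF DERIV_mult[OF D insert.IH]])
        (use torus_coord_nonzero[OF x, of j] in \<open>simp add: power_int_diff field_simps\<close>)
  qed simp
  from this[of UNIV] show ?thesis
    by (simp add: torus_char_def)
qed

lemma has_field_derivative_laurent_line:
  assumes "laurent f" "x \<in> torus"
  shows "((\<lambda>t. f (x + t *s u)) has_field_derivative dir_deriv f x u) (at 0)"
proof -
  from assms(1) obtain S c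
    where S: "finite S" "\<And>x. x \<in> torus \<Longrightarrow> f x = (\<Sum>a\<in>S. c a * torus_char a x)"
    unfolding laurent_def by meson
  have "((\<lambda>t. \<Sum>a\<in>S. c a * torus_char a (x + t *s u)) has_field_derivative
      (\<Sum>a\<in>S. c a * (torus_char a x * (\<Sum>i\<in>UNIV. of_int (a i) * (u $ i / x $ i))))) (at 0)"
    by (intro DERIV_sum DERIV_cmult has_field_derivative_char_line assms)
  moreover have "\<forall>\<^sub>F t in nhds 0. (\<Sum>a\<in>S. c a * torus_char a (x + t *s u)) = f (x + t *s u)"
    using eventually_line_in_torus[OF assms(2), of u] by eventually_elim (simp add: S)
  ultimately have D: "((\<lambda>t. f (x + t *s u)) has_field_derivative
      (\<Sum>a\<in>S. c a * (torus_char a x * (\<Sum>i\<in>UNIV. of_int (a i) * (u $ i / x $ i))))) (at 0)"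
    by (simp add: DERIV_cong_ev)
  show ?thesis
    unfolding dir_deriv_def DERIV_imp_deriv[OF D] by (rule D)
qed

lemma dir_deriv_char:
  "x \<in> torus \<Longrightarrow>
    dir_deriv (torus_char a) x u = torus_char a x * (\<Sum>i\<in>UNIV. of_int (a i) * (u $ i / x $ i))"
  unfolding dir_deriv_def by (intro DERIV_imp_deriv has_field_derivative_char_line)

lemma dir_deriv_add:
  "laurent f \<Longrightarrow> laurent g \<Longrightarrow> x \<in> torus \<Longrightarrow>
    dir_deriv (\<lambda>y. f y + g y) x u = dir_deriv f x u + dir_deriv g x u"
  unfolding dir_deriv_def[of "\<lambda>y. f y + g y"]
  by (intro DERIV_imp_deriv DERIV_add has_field_derivative_laurent_line)

lemma dir_deriv_scale:
  "laurent f \<Longrightarrow> x \<in> torus \<Longrightarrow> dir_deriv (\<lambda>y. c * f y) x u = c * dir_deriv f x u"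
  unfolding dir_deriv_def[of "\<lambda>y. c * f y"]
  by (intro DERIV_imp_deriv DERIV_cmult has_field_derivative_laurent_line)

lemma dir_deriv_sum:
  "finite I \<Longrightarrow> (\<And>i. i \<in> I \<Longrightarrow> laurent (f i)) \<Longrightarrow> x \<in> torus \<Longrightarrow>
    dir_deriv (\<lambda>y. \<Sum>i\<in>I. f i y) x u = (\<Sum>i\<in>I. dir_deriv (f i) x u)"
  unfolding dir_deriv_def[of "\<lambda>y. \<Sum>i\<in>I. f i y"]
  by (intro DERIV_imp_deriv DERIV_sum has_field_derivative_laurent_line)

text \<open>
  The exponents are indexed by a further map \<open>e\<close> so that the same exponent may occur several times;
  the forms below are expanded over pairs of a weight and a coordinate.
\<close>

lemma dir_deriv_char_sum:
  assumes "finite S" "\<And>y. y \<in> torus \<Longrightarrow> f y = (\<Sum>a\<in>S. c a * torus_char (e a) y)" "x \<in> torus"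
  shows "dir_deriv f x u =
    (\<Sum>a\<in>S. c a * (torus_char (e a) x * (\<Sum>i\<in>UNIV. of_int (e a i) * (u $ i / x $ i))))"
proof -
  have "dir_deriv f x u = dir_deriv (\<lambda>y. \<Sum>a\<in>S. c a * torus_char (e a) y) x u"
    by (intro dir_deriv_cong assms)
  then show ?thesis
    using assms by (simp add: dir_deriv_sum laurent_scale laurent_char dir_deriv_scale dir_deriv_char)
qed

lemma dir_deriv_direction_sum:
  assumes "laurent f" "x \<in> torus" "finite I"
  shows "dir_deriv f x (\<Sum>i\<in>I. u i) = (\<Sum>i\<in>I. dir_deriv f x (u i))"
proof -
  from assms(1) obtain S c
    where S: "finite S" "\<And>y. y \<in> torus \<Longrightarrow> f y = (\<Sum>a\<in>S. c a * torus_char a y)"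
    unfolding laurent_def by meson
  have D: "dir_deriv f x v =
      (\<Sum>a\<in>S. c a * (torus_char a x * (\<Sum>k\<in>UNIV. of_int (a k) * (v $ k / x $ k))))" for v
    by (rule dir_deriv_char_sum[OF S assms(2)])
  have "(\<Sum>k\<in>UNIV. of_int (a k) * ((\<Sum>i\<in>I. u i) $ k / x $ k)) =
      (\<Sum>i\<in>I. \<Sum>k\<in>UNIV. of_int (a k) * (u i $ k / x $ k))" for a
    by (subst sum.swap) (simp add: sum_divide_distrib sum_distrib_left)
  then have "dir_deriv f x (\<Sum>i\<in>I. u i) =
      (\<Sum>a\<in>S. \<Sum>i\<in>I. c a * (torus_char a x * (\<Sum>k\<in>UNIV. of_int (a k) * (u i $ k / x $ k))))"
    unfolding D by (simp only: sum_distrib_left)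
  also have "\<dots> = (\<Sum>i\<in>I. dir_deriv f x (u i))"
    unfolding D by (rule sum.swap)
  finally show ?thesis .
qed

section \<open>Closed one-forms in the logarithmic frame\<close>

text \<open>
  The form is \<open>\<alpha> = \<Sum>\<^sub>k F\<^sub>k dx\<^sub>k / x\<^sub>k\<close> with Laurent polynomials \<open>F\<^sub>k\<close>. The one-forms \<open>dx\<^sub>k / x\<^sub>k\<close> are
  closed, so \<open>d\<alpha>\<close> involves only the derivatives of the \<open>F\<^sub>k\<close>, and the operators \<open>x\<^sub>l \<partial>/\<partial>x\<^sub>l\<close> act
  diagonally on characters, with the entries of the exponent as eigenvalues.
\<close>

lemma exterior_derivative_log_form:
  fixes A :: "('m::finite \<Rightarrow> int) \<Rightarrow> 'm \<Rightarrow> complex"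
  assumes S: "finite S"
    and \<alpha>: "\<And>y v. y \<in> torus \<Longrightarrow> \<alpha> y v = (\<Sum>k\<in>UNIV. (\<Sum>a\<in>S. A a k * torus_char a y) * (v $ k / y $ k))"
    and x: "x \<in> torus"
  shows "dir_deriv (\<lambda>y. \<alpha> y v) x u - dir_deriv (\<lambda>y. \<alpha> y u) x v =
    (\<Sum>k\<in>UNIV. \<Sum>l\<in>UNIV. (v $ k / x $ k) * (u $ l / x $ l) *
       (\<Sum>a\<in>S. (A a k * of_int (a l) - A a l * of_int (a k)) * torus_char a x))"
proof -
  have D: "dir_deriv (\<lambda>y. \<alpha> y v) x u =
      (\<Sum>k\<in>UNIV. \<Sum>l\<in>UNIV. (v $ k / x $ k) * (u $ l / x $ l) *
         (\<Sum>a\<in>S. A a k * of_int (a l) * torus_char a x)) -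
      (\<Sum>k\<in>UNIV. (v $ k / x $ k) * (u $ k / x $ k) * (\<Sum>a\<in>S. A a k * torus_char a x))" for u v
  proof -
    \<comment> \<open>The factor \<open>1 / y $ k\<close> of the frame is absorbed into the exponent; its derivative is the last
      sum, which is symmetric in \<open>u\<close> and \<open>v\<close> and cancels in the exterior derivative.\<close>
    let ?e = "\<lambda>p i. fst p i + - of_bool (i = snd p)"
    have "\<alpha> y v = (\<Sum>p\<in>S \<times> UNIV. A (fst p) (snd p) * v $ snd p * torus_char (?e p) y)"
      if y: "y \<in> torus" for y
    proof -
      have "\<alpha> y v = (\<Sum>k\<in>UNIV. \<Sum>a\<in>S. A a k * v $ k * torus_char (?e (a, k)) y)"
        unfolding \<alpha>[OF y] torus_char_add[OF y] torus_char_inverse[OF y] torus_char_coord fst_conv snd_conv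
        by (simp add: sum_distrib_left sum_distrib_right field_simps)
      then show ?thesis
        by (subst (asm) sum.swap) (simp add: sum.cartesian_product case_prod_beta)
    qed
    from dir_deriv_char_sum[OF _ this x]
    have "dir_deriv (\<lambda>y. \<alpha> y v) x u = (\<Sum>p\<in>S \<times> UNIV. A (fst p) (snd p) * v $ snd p *
        (torus_char (?e p) x * (\<Sum>i\<in>UNIV. of_int (?e p i) * (u $ i / x $ i))))"
      using S by simp
    also have "\<dots> = (\<Sum>a\<in>S. \<Sum>k\<in>UNIV. A a k * v $ k *
        (torus_char (?e (a, k)) x * (\<Sum>i\<in>UNIV. of_int (?e (a, k) i) * (u $ i / x $ i))))"
      by (simp add: sum.cartesian_product case_prod_beta)
    also have "\<dots> = (\<Sum>k\<in>UNIV. \<Sum>a\<in>S. A a k * v $ k *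
        (torus_char (?e (a, k)) x * (\<Sum>i\<in>UNIV. of_int (?e (a, k) i) * (u $ i / x $ i))))"
      by (rule sum.swap)
    also have "\<dots> = (\<Sum>k\<in>UNIV. \<Sum>a\<in>S. (v $ k / x $ k) * A a k * torus_char a x *
        ((\<Sum>l\<in>UNIV. of_int (a l) * (u $ l / x $ l)) - u $ k / x $ k))"
    proof (intro sum.cong refl)
      fix k a
      have "(\<Sum>i\<in>UNIV. of_int (?e (a, k) i) * (u $ i / x $ i)) =
          (\<Sum>l\<in>UNIV. of_int (a l) * (u $ l / x $ l) - (if l = k then u $ l / x $ l else 0))"
        by (intro sum.cong) (auto simp: algebra_simps diff_divide_distrib)
      then have "(\<Sum>i\<in>UNIV. of_int (?e (a, k) i) * (u $ i / x $ i)) =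
          (\<Sum>l\<in>UNIV. of_int (a l) * (u $ l / x $ l)) - u $ k / x $ k"
        by (simp add: sum_subtractf)
      moreover have "torus_char (?e (a, k)) x = torus_char a x / x $ k"
        unfolding torus_char_add[OF x] torus_char_inverse[OF x] torus_char_coord fst_conv snd_conv
        by (simp add: field_simps)
      ultimately show "A a k * v $ k *
          (torus_char (?e (a, k)) x * (\<Sum>i\<in>UNIV. of_int (?e (a, k) i) * (u $ i / x $ i))) =
        (v $ k / x $ k) * A a k * torus_char a x *
          ((\<Sum>l\<in>UNIV. of_int (a l) * (u $ l / x $ l)) - u $ k / x $ k)"
        by simp
    qed
    also have "\<dots> = (\<Sum>k\<in>UNIV. (\<Sum>l\<in>UNIV. (v $ k / x $ k) * (u $ l / x $ l) *
         (\<Sum>a\<in>S. A a k * of_int (a l) * torus_char a x)) -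
         (v $ k / x $ k) * (u $ k / x $ k) * (\<Sum>a\<in>S. A a k * torus_char a x))"
    proof (intro sum.cong refl)
      fix k
      have "(\<Sum>l\<in>UNIV. (v $ k / x $ k) * (u $ l / x $ l) *
          (\<Sum>a\<in>S. A a k * of_int (a l) * torus_char a x)) =
          (\<Sum>l\<in>UNIV. \<Sum>a\<in>S. (v $ k / x $ k) * A a k * torus_char a x * (of_int (a l) * (u $ l / x $ l)))"
        by (simp add: sum_distrib_left sum_divide_distrib mult_ac)
      also have "\<dots> = (\<Sum>a\<in>S. \<Sum>l\<in>UNIV. (v $ k / x $ k) * A a k * torus_char a x * (of_int (a l) * (u $ l / x $ l)))"
        by (rule sum.swap)
      also have "\<dots> = (\<Sum>a\<in>S. (v $ k / x $ k) * A a k * torus_char a x * (\<Sum>l\<in>UNIV. of_int (a l) * (u $ l / x $ l)))"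
        by (simp only: sum_distrib_left)
      finally have 1: "(\<Sum>l\<in>UNIV. (v $ k / x $ k) * (u $ l / x $ l) *
          (\<Sum>a\<in>S. A a k * of_int (a l) * torus_char a x)) = \<dots>" .
      show "(\<Sum>a\<in>S. (v $ k / x $ k) * A a k * torus_char a x *
          ((\<Sum>l\<in>UNIV. of_int (a l) * (u $ l / x $ l)) - u $ k / x $ k)) =
        (\<Sum>l\<in>UNIV. (v $ k / x $ k) * (u $ l / x $ l) *
           (\<Sum>a\<in>S. A a k * of_int (a l) * torus_char a x)) -
         (v $ k / x $ k) * (u $ k / x $ k) * (\<Sum>a\<in>S. A a k * torus_char a x)"
        unfolding 1 right_diff_distrib sum_subtractf by (simp add: sum_distrib_left sum_divide_distrib mult_ac)
    qed
    finally show ?thesis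
      by (simp add: sum_subtractf)
  qed
  have "(\<Sum>k\<in>UNIV. \<Sum>l\<in>UNIV. (u $ k / x $ k) * (v $ l / x $ l) *
         (\<Sum>a\<in>S. A a k * of_int (a l) * torus_char a x)) =
      (\<Sum>k\<in>UNIV. \<Sum>l\<in>UNIV. (v $ k / x $ k) * (u $ l / x $ l) *
         (\<Sum>a\<in>S. A a l * of_int (a k) * torus_char a x))"
    by (subst sum.swap) (simp add: mult_ac)
  then show ?thesis
    unfolding D[of v u] D[of u v]
    by (simp add: left_diff_distrib sum_subtractf right_diff_distrib mult_ac)
qed

text \<open>
  Evaluating the exterior derivative on the frame fields \<open>x\<^sub>k \<partial>/\<partial>x\<^sub>k\<close> isolates one Laurent polynomial
  for each pair \<open>k, l\<close>; independence of characters then gives the vanishing weight by weight.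
\<close>

lemma closed_log_form_iff:
  fixes A :: "('m::finite \<Rightarrow> int) \<Rightarrow> 'm \<Rightarrow> complex"
  assumes S: "finite S"
    and \<alpha>: "\<And>y v. y \<in> torus \<Longrightarrow> \<alpha> y v = (\<Sum>k\<in>UNIV. (\<Sum>a\<in>S. A a k * torus_char a y) * (v $ k / y $ k))"
  shows "closed_form1 torus \<alpha> \<longleftrightarrow>
    (\<forall>a\<in>S. \<forall>k l. A a k * of_int (a l) = A a l * of_int (a k))"
proof
  assume closed: "closed_form1 torus \<alpha>"
  have "A a k * of_int (a l) - A a l * of_int (a k) = 0" if a: "a \<in> S" for a k l
  proof (rule torus_char_independent[OF S _ a])
    fix x :: "complex ^ 'm"
    assume x: "x \<in> torus"
    let ?B = "\<lambda>k l. \<Sum>a\<in>S. (A a k * of_int (a l) - A a l * of_int (a k)) * torus_char a x"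
    have delta: "(\<Sum>i\<in>UNIV. \<Sum>j\<in>UNIV. (if i = k then 1 else 0) * (if j = l then 1 else 0) * F i j) =
        F k l" for F :: "'m \<Rightarrow> 'm \<Rightarrow> complex"
    proof -
      have "(\<Sum>i\<in>UNIV. \<Sum>j\<in>UNIV. (if i = k then 1 else 0) * (if j = l then 1 else 0) * F i j) =
          (\<Sum>i\<in>UNIV. (if i = k then 1 else 0) * (\<Sum>j\<in>UNIV. (if j = l then 1 else 0) * F i j))"
        by (simp only: sum_distrib_left mult.assoc)
      then show ?thesis
        by (simp add: mult_delta_left)
    qed
    have unit: "axis k (x $ k) $ i / x $ i = (if i = k then 1 else 0)" for k i
      using torus_coord_nonzero[OF x] by (simp add: axis_def)
    have "0 = (\<Sum>i\<in>UNIV. \<Sum>j\<in>UNIV.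
        (axis k (x $ k) $ i / x $ i) * (axis l (x $ l) $ j / x $ j) * ?B i j)"
      using closed x unfolding closed_form1_def
      by (subst exterior_derivative_log_form[OF S \<alpha> x, symmetric]) simp_all
    also have "\<dots> = ?B k l"
      unfolding unit by (rule delta)
    finally show "?B k l = 0"
      by simp
  qed
  then show "\<forall>a\<in>S. \<forall>k l. A a k * of_int (a l) = A a l * of_int (a k)"
    by simp
next
  assume "\<forall>a\<in>S. \<forall>k l. A a k * of_int (a l) = A a l * of_int (a k)"
  then show "closed_form1 torus \<alpha>"
    unfolding closed_form1_def using exterior_derivative_log_form[OF S \<alpha>] by simp
qed

section \<open>Homogeneous vector fields\<close>

definition char_field :: "('m \<Rightarrow> int) \<Rightarrow> ('m \<Rightarrow> complex) \<Rightarrow> 'm::finite vfield" where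
  "char_field a c x = (if x \<in> torus then \<chi> i. c i * torus_char a x * x $ i else 0)"

lemma algebraic_vfield_iff_laurent:
  "algebraic_vfield coord_prod V \<longleftrightarrow>
    (\<forall>i. laurent (\<lambda>x. V x $ i)) \<and> (\<forall>x. x \<notin> torus \<longrightarrow> V x = 0)"
  by (simp add: algebraic_vfield_def regular_iff_laurent)

lemma algebraic_char_field: "algebraic_vfield coord_prod (char_field a c)"
proof -
  have "laurent (\<lambda>x. char_field a c x $ i)" for i
    by (rule laurent_cong[OF laurent_scale[OF laurent_mult[OF laurent_char[of a] laurent_coord[of i]], of "c i"]])
      (simp add: char_field_def)
  then show ?thesis
    by (simp add: algebraic_vfield_iff_laurent char_field_def)
qed

text \<open>
  Each component divided by its coordinate is a Laurent polynomial; padding with zero coefficients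
  gives all components the same finite set of weights.
\<close>

lemma algebraic_vfield_decomposition:
  fixes V :: "'m::finite vfield"
  assumes "algebraic_vfield coord_prod V"
  obtains S c where "finite S" "V = (\<lambda>x. \<Sum>a\<in>S. char_field a (c a) x)"
proof -
  have "\<exists>S c. finite S \<and> (\<forall>x\<in>torus. V x $ i * inverse (x $ i) = (\<Sum>a\<in>S. c a * torus_char a x))" for i
  proof -
    have "laurent (\<lambda>x. V x $ i * inverse (x $ i))"
      using assms by (simp add: algebraic_vfield_iff_laurent laurent_mult laurent_coord_inverse)
    then show ?thesis
      unfolding laurent_def .
  qed
  then obtain S c where S: "\<And>i. finite (S i)"
      and V: "\<And>i x. x \<in> torus \<Longrightarrow> V x $ i * inverse (x $ i) = (\<Sum>a\<in>S i. c i a * torus_char a x)"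
    by metis
  let ?S = "\<Union>i. S i" and ?c = "\<lambda>a i. if a \<in> S i then c i a else 0"
  have "V x = (\<Sum>a\<in>?S. char_field a (?c a) x)" for x
  proof (cases "x \<in> torus")
    case True
    have "V x $ i = (\<Sum>a\<in>?S. ?c a i * torus_char a x * x $ i)" for i
    proof -
      have "V x $ i = (\<Sum>a\<in>S i. c i a * torus_char a x) * x $ i"
        using V[OF True, of i] torus_coord_nonzero[OF True, of i] by (simp add: field_simps)
      also have "(\<Sum>a\<in>S i. c i a * torus_char a x) = (\<Sum>a\<in>?S. ?c a i * torus_char a x)"
        using S by (intro sum.mono_neutral_cong_left) auto
      finally show ?thesis
        by (simp add: sum_distrib_right)
    qed
    then show ?thesis
      using True by (simp add: vec_eq_iff char_field_def)
  next
    case False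
    then show ?thesis
      using assms by (simp add: algebraic_vfield_iff_laurent char_field_def)
  qed
  then have "V = (\<lambda>x. \<Sum>a\<in>?S. char_field a (?c a) x)"
    by (rule ext)
  moreover have "finite ?S"
    using S by simp
  ultimately show ?thesis
    by (rule that[rotated])
qed

section \<open>Symplectic vector fields\<close>

text \<open>
  Coefficients of the contraction of the form with \<open>\<Sum>\<^sub>i c\<^sub>i x\<^sub>i \<partial>/\<partial>x\<^sub>i\<close>, in the coframe \<open>dx\<^sub>k / x\<^sub>k\<close>:
  the musical isomorphism in the logarithmic frame.
\<close>

definition flat_coeff :: "('n + 'n \<Rightarrow> complex) \<Rightarrow> 'n + 'n \<Rightarrow> complex" where
  "flat_coeff c k = (case k of Inl j \<Rightarrow> - c (Inr j) | Inr j \<Rightarrow> c (Inl j))"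

lemma sum_UNIV_Plus:
  fixes f :: "'n::finite + 'n \<Rightarrow> complex"
  shows "(\<Sum>k\<in>UNIV. f k) = (\<Sum>j\<in>UNIV. f (Inl j) + f (Inr j))"
  by (simp add: UNIV_Plus_UNIV[symmetric] sum.Plus sum.distrib del: UNIV_Plus_UNIV)

lemma flat_log_field:
  assumes "\<And>i. V $ i = c i * x $ i" "x \<in> torus"
  shows "log_symplectic_form x V v = (\<Sum>k\<in>UNIV. flat_coeff c k * (v $ k / x $ k))"
  using torus_coord_nonzero[OF assms(2)]
  by (simp add: log_symplectic_form_def wedge_def dlog_coord_def sum_UNIV_Plus flat_coeff_def assms(1)
      algebra_simps)

text \<open>
  The vectors \<open>flat_coeff c\<close> and \<open>a\<close> are linearly dependent. For \<open>a \<noteq> 0\<close> the homogeneous field then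
  has a multiple of the character of \<open>a\<close> as Hamiltonian; for \<open>a = 0\<close> every \<open>c\<close> is
  admitted, as the contractions of invariant fields are closed, though exact only for \<open>c = 0\<close>.
\<close>

definition symplectic_coeff :: "('n + 'n \<Rightarrow> int) \<Rightarrow> ('n + 'n \<Rightarrow> complex) \<Rightarrow> bool" where
  "symplectic_coeff a c \<longleftrightarrow>
     (\<forall>k l. flat_coeff c k * of_int (a l) = flat_coeff c l * of_int (a k))"

lemma flat_coeff_sum: "flat_coeff (\<lambda>i. \<Sum>a\<in>S. c a i) k = (\<Sum>a\<in>S. flat_coeff (c a) k)"
  by (cases k) (simp_all add: flat_coeff_def sum_negf)

lemma flat_coeff_scale: "flat_coeff (\<lambda>i. c i * r) k = flat_coeff c k * r"
  by (cases k) (simp_all add: flat_coeff_def)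

lemma symplectic_char_sum_iff:
  fixes c :: "('n::finite + 'n \<Rightarrow> int) \<Rightarrow> 'n + 'n \<Rightarrow> complex"
  assumes "finite S"
  shows "symplectic_vfield torus log_symplectic_form (\<lambda>x. \<Sum>a\<in>S. char_field a (c a) x) \<longleftrightarrow>
    (\<forall>a\<in>S. symplectic_coeff a (c a))"
proof -
  have "contraction (\<lambda>x. \<Sum>a\<in>S. char_field a (c a) x) log_symplectic_form y v =
      (\<Sum>k\<in>UNIV. (\<Sum>a\<in>S. flat_coeff (c a) k * torus_char a y) * (v $ k / y $ k))"
    if y: "y \<in> torus" for y v
  proof -
    have "contraction (\<lambda>x. \<Sum>a\<in>S. char_field a (c a) x) log_symplectic_form y v =
      (\<Sum>k\<in>UNIV. flat_coeff (\<lambda>i. \<Sum>a\<in>S. c a i * torus_char a y) k * (v $ k / y $ k))"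
      unfolding contraction_def
      by (rule flat_log_field) (simp_all add: y char_field_def sum_distrib_right)
    then show ?thesis
      by (simp only: flat_coeff_sum flat_coeff_scale)
  qed
  then show ?thesis
    unfolding symplectic_vfield_def
    by (subst closed_log_form_iff[OF assms]) (auto simp: symplectic_coeff_def)
qed

lemma symplectic_char_field_iff:
  "symplectic_vfield torus log_symplectic_form (char_field a c) \<longleftrightarrow> symplectic_coeff a c"
  using symplectic_char_sum_iff[of "{a}" "\<lambda>_. c"] by simp

text \<open>
  A Hamiltonian field annihilates its own Hamiltonian. The conditions for the conjugate pairs
  \<open>Inl j\<close>, \<open>Inr j\<close> already suffice.
\<close>

lemma symplectic_coeff_annihilates:
  fixes a :: "'n::finite + 'n \<Rightarrow> int"
  assumes "symplectic_coeff a c"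
  shows "(\<Sum>i\<in>UNIV. of_int (a i) * c i) = 0"
proof -
  have "of_int (a (Inl j)) * c (Inl j) + of_int (a (Inr j)) * c (Inr j) = 0" for j
    using assms[unfolded symplectic_coeff_def, rule_format, of "Inl j" "Inr j"]
    by (simp add: flat_coeff_def add_eq_0_iff2 mult.commute)
  then show ?thesis
    by (simp add: sum_UNIV_Plus)
qed

section \<open>Completeness\<close>

lemma has_derivative_componentwise_vec:
  fixes \<phi> :: "complex \<Rightarrow> complex ^ 'm::finite"
  assumes "\<And>i. ((\<lambda>t. \<phi> t $ i) has_field_derivative D $ i) (at t)"
  shows "(\<phi> has_derivative (\<lambda>h. h *s D)) (at t)"
  unfolding has_derivative_componentwise_within[of \<phi>]
proof
  fix b :: "complex ^ 'm"
  assume "b \<in> Basis"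
  then obtain i r where b: "b = axis i r"
    by (auto simp: Basis_vec_def)
  have "((\<lambda>t. \<phi> t $ i) has_derivative (\<lambda>h. D $ i * h)) (at t)"
    using assms[of i] by (simp add: has_field_derivative_def)
  from has_derivative_inner_left[OF this, of r]
  show "((\<lambda>t. \<phi> t \<bullet> b) has_derivative (\<lambda>h. (h *s D) \<bullet> b)) (at t)"
    by (simp add: b inner_axis mult.commute)
qed

text \<open>
  The hypothesis says that the character of \<open>a\<close> is a first integral. Along a trajectory the field
  thus agrees with an invariant field on the torus, whose flow is a one-parameter subgroup.
\<close>

lemma complete_char_field:
  fixes a :: "'m::finite \<Rightarrow> int"
  assumes "(\<Sum>i\<in>UNIV. of_int (a i) * c i) = 0"
  shows "complete_vfield torus (char_field a c)"
  unfolding complete_vfield_def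
proof
  fix x :: "complex ^ 'm"
  assume x: "x \<in> torus"
  define \<phi> where "\<phi> t = (\<chi> i. x $ i * exp (t * (c i * torus_char a x)))" for t
  have \<phi>: "\<phi> t \<in> torus" for t
    using x by (simp add: \<phi>_def principal_open_coord_prod)
  have const: "torus_char a (\<phi> t) = torus_char a x" for t
  proof -
    have "torus_char a (\<phi> t) = torus_char a x * (\<Prod>i\<in>UNIV. exp (of_int (a i) * (t * (c i * torus_char a x))))"
      by (simp add: torus_char_def \<phi>_def power_int_mult_distrib exp_power_int prod.distrib)
    also have "(\<Prod>i\<in>UNIV. exp (of_int (a i) * (t * (c i * torus_char a x)))) =
        exp (t * torus_char a x * (\<Sum>i\<in>UNIV. of_int (a i) * c i))"
      by (simp add: exp_sum sum_distrib_left mult_ac)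
    finally show ?thesis
      by (simp add: assms)
  qed
  have "(\<phi> has_derivative (\<lambda>h. h *s char_field a c (\<phi> t))) (at t)" for t
  proof (rule has_derivative_componentwise_vec)
    fix i
    have "((\<lambda>t. x $ i * exp (t * (c i * torus_char a x))) has_field_derivative
        x $ i * (exp (t * (c i * torus_char a x)) * (c i * torus_char a x))) (at t)"
      by (auto intro!: derivative_eq_intros)
    then show "((\<lambda>t. \<phi> t $ i) has_field_derivative char_field a c (\<phi> t) $ i) (at t)"
      using \<phi>[of t] const[of t] by (simp add: \<phi>_def char_field_def mult_ac)
  qed
  moreover have "\<phi> 0 = x"
    by (simp add: \<phi>_def vec_eq_iff)
  ultimately show "\<exists>\<phi>. \<phi> 0 = x \<and> (\<forall>t. \<phi> t \<in> torus \<and>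
      (\<phi> has_derivative (\<lambda>h. h *s char_field a c (\<phi> t))) (at t))"
    using \<phi> by blast
qed

section \<open>The Lie algebra of symplectic vector fields\<close>

lemma laurent_contraction:
  assumes "algebraic_vfield coord_prod V"
  shows "laurent (\<lambda>y. contraction V log_symplectic_form y v)"
proof -
  have V: "laurent (\<lambda>y. V y $ i)" for i
    using assms by (simp add: algebraic_vfield_iff_laurent)
  have "laurent (\<lambda>y. \<Sum>j\<in>UNIV. inverse (y $ Inl j) * inverse (y $ Inr j) *
      (v $ Inr j * V y $ Inl j + - v $ Inl j * V y $ Inr j))"
    by (intro laurent_sum laurent_mult laurent_add laurent_scale laurent_coord_inverse V) simp
  then show ?thesis
    by (rule laurent_cong)
      (simp add: contraction_def log_symplectic_form_def wedge_def dlog_coord_def field_simps diff_divide_distrib)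
qed

lemma log_symplectic_form_add:
  "log_symplectic_form x (u + u') v = log_symplectic_form x u v + log_symplectic_form x u' v"
  by (simp add: log_symplectic_form_def wedge_def dlog_coord_def sum.distrib[symmetric]
      add_divide_distrib algebra_simps)

lemma log_symplectic_form_scale:
  "log_symplectic_form x (c *s u) v = c * log_symplectic_form x u v"
  by (simp add: log_symplectic_form_def wedge_def dlog_coord_def sum_distrib_left algebra_simps)

lemma log_symplectic_form_swap:
  "log_symplectic_form x u v = - log_symplectic_form x v u"
  by (simp add: log_symplectic_form_def wedge_def dlog_coord_def sum_negf[symmetric] algebra_simps)

definition symplectic_algebra :: "('n::finite + 'n) vfield set" where
  "symplectic_algebra =
     {V. algebraic_vfield coord_prod V \<and> symplectic_vfield torus log_symplectic_form V}"

lemma symplectic_algebra_add: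
  assumes "V \<in> symplectic_algebra" "W \<in> symplectic_algebra"
  shows "(\<lambda>x. V x + W x) \<in> symplectic_algebra"
proof -
  have V: "algebraic_vfield coord_prod V" and W: "algebraic_vfield coord_prod W"
    using assms by (simp_all add: symplectic_algebra_def)
  have "contraction (\<lambda>x. V x + W x) log_symplectic_form y v =
      contraction V log_symplectic_form y v + contraction W log_symplectic_form y v" for y v
    by (simp add: contraction_def log_symplectic_form_add)
  then have "symplectic_vfield torus log_symplectic_form (\<lambda>x. V x + W x)"
    using assms unfolding symplectic_algebra_def symplectic_vfield_def closed_form1_def
    by (simp add: dir_deriv_add laurent_contraction)
  moreover have "algebraic_vfield coord_prod (\<lambda>x. V x + W x)"
    using V W by (simp add: algebraic_vfield_iff_laurent laurent_add)
  ultimately show ?thesis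
    by (simp add: symplectic_algebra_def)
qed

lemma symplectic_algebra_scale:
  assumes "V \<in> symplectic_algebra"
  shows "(\<lambda>x. c *s V x) \<in> symplectic_algebra"
proof -
  have V: "algebraic_vfield coord_prod V"
    using assms by (simp add: symplectic_algebra_def)
  have "contraction (\<lambda>x. c *s V x) log_symplectic_form y v =
      c * contraction V log_symplectic_form y v" for y v
    by (simp add: contraction_def log_symplectic_form_scale)
  then have "symplectic_vfield torus log_symplectic_form (\<lambda>x. c *s V x)"
    using assms unfolding symplectic_algebra_def symplectic_vfield_def closed_form1_def
    by (simp add: dir_deriv_scale laurent_contraction flip: right_diff_distrib)
  moreover have "algebraic_vfield coord_prod (\<lambda>x. c *s V x)"
    using V by (simp add: algebraic_vfield_iff_laurent laurent_scale)
  ultimately show ?thesis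
    by (simp add: symplectic_algebra_def)
qed

lemma char_field_in_symplectic_algebra_iff:
  "char_field a c \<in> symplectic_algebra \<longleftrightarrow> symplectic_coeff a c"
  by (simp add: symplectic_algebra_def algebraic_char_field symplectic_char_field_iff)

lemma symplectic_algebra_zero: "(\<lambda>x. 0) \<in> symplectic_algebra"
proof -
  have "symplectic_coeff (\<lambda>_ :: 'a + 'a. 0) (\<lambda>_. 0)"
    by (simp add: symplectic_coeff_def)
  then have "char_field (\<lambda>_ :: 'a + 'a. 0) (\<lambda>_. 0) \<in> symplectic_algebra"
    by (simp add: char_field_in_symplectic_algebra_iff)
  moreover have "char_field (\<lambda>_. 0) (\<lambda>_. 0) = (\<lambda>x :: complex ^ ('a + 'a). 0)"
    by (auto simp: char_field_def vec_eq_iff)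
  ultimately show ?thesis
    by simp
qed

lemma symplectic_algebra_sum:
  "finite I \<Longrightarrow> (\<And>i. i \<in> I \<Longrightarrow> V i \<in> symplectic_algebra) \<Longrightarrow> (\<lambda>x. \<Sum>i\<in>I. V i x) \<in> symplectic_algebra"
  by (induction I rule: finite_induct) (auto intro: symplectic_algebra_add symplectic_algebra_zero)

lemma symplectic_algebra_decomposition:
  assumes "V \<in> symplectic_algebra"
  obtains S c where "finite S" "\<forall>a\<in>S. symplectic_coeff a (c a)"
    "V = (\<lambda>x. \<Sum>a\<in>S. char_field a (c a) x)"
proof -
  have V: "algebraic_vfield coord_prod V" "symplectic_vfield torus log_symplectic_form V"
    using assms by (simp_all add: symplectic_algebra_def)
  obtain S c where S: "finite S" "V = (\<lambda>x. \<Sum>a\<in>S. char_field a (c a) x)"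
    by (rule algebraic_vfield_decomposition[OF V(1)])
  then show ?thesis
    using V(2) that[of S c] symplectic_char_sum_iff[OF S(1)] by simp
qed

text \<open>
  The summand \<open>c i\<close> comes from the factor \<open>x $ i\<close> in the component; it is symmetric in the two
  fields and cancels in their bracket.
\<close>

lemma dir_deriv_char_field:
  assumes x: "x \<in> torus"
  shows "dir_deriv (\<lambda>y. char_field b d y $ i) x (char_field a c x) =
    d i * torus_char a x * torus_char b x * x $ i * ((\<Sum>k\<in>UNIV. of_int (b k) * c k) + c i)"
proof -
  let ?e = "\<lambda>k. b k + of_bool (k = i)"
  have char: "torus_char ?e y = torus_char b y * y $ i" if "y \<in> torus" for y
    using that by (simp add: torus_char_add torus_char_coord)
  have "dir_deriv (\<lambda>y. char_field b d y $ i) x (char_field a c x) =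
      dir_deriv (\<lambda>y. d i * torus_char ?e y) x (char_field a c x)"
    by (intro dir_deriv_cong x) (simp add: char char_field_def)
  also have "\<dots> = d i * (torus_char b x * x $ i *
      (\<Sum>k\<in>UNIV. of_int (?e k) * (char_field a c x $ k / x $ k)))"
    by (simp only: dir_deriv_scale laurent_char dir_deriv_char x char)
  also have "(\<Sum>k\<in>UNIV. of_int (?e k) * (char_field a c x $ k / x $ k)) =
      (\<Sum>k\<in>UNIV. torus_char a x * (of_int (b k) * c k) + (if k = i then torus_char a x * c k else 0))"
    using x torus_coord_nonzero[OF x]
    by (intro sum.cong) (auto simp: char_field_def algebra_simps)
  also have "\<dots> = torus_char a x * ((\<Sum>k\<in>UNIV. of_int (b k) * c k) + c i)"
    by (simp add: sum.distrib sum_distrib_left distrib_left)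
  finally show ?thesis
    by (simp add: mult_ac)
qed

lemma lie_bracket_char_field:
  "lie_bracket torus (char_field a c) (char_field b d) =
    char_field (\<lambda>k. a k + b k)
      (\<lambda>i. (\<Sum>k\<in>UNIV. of_int (b k) * c k) * d i - (\<Sum>k\<in>UNIV. of_int (a k) * d k) * c i)"
proof
  fix x
  show "lie_bracket torus (char_field a c) (char_field b d) x =
    char_field (\<lambda>k. a k + b k)
      (\<lambda>i. (\<Sum>k\<in>UNIV. of_int (b k) * c k) * d i - (\<Sum>k\<in>UNIV. of_int (a k) * d k) * c i) x"
  proof (cases "x \<in> torus")
    case True
    then show ?thesis
      unfolding lie_bracket_def
      by (simp add: dir_deriv_char_field vec_eq_iff)
        (simp add: char_field_def torus_char_add algebra_simps)
  qed (simp add: lie_bracket_def char_field_def)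
qed

text \<open>
  If both weights are nonzero, the flattened coefficients are multiples of the weights, and both
  pairings in the bracket are multiples of the same value of the dual symplectic pairing of
  \<open>a\<close> and \<open>b\<close>, with opposite signs: the Poisson bracket of two characters is a multiple of their
  product. If a weight vanishes, the pairing with it vanishes, and with it the term that the
  symplectic condition at that weight leaves uncontrolled.
\<close>

lemma symplectic_coeff_bracket:
  fixes a b :: "'n::finite + 'n \<Rightarrow> int"
  assumes a: "symplectic_coeff a c" and b: "symplectic_coeff b d"
  shows "symplectic_coeff (\<lambda>k. a k + b k)
    (\<lambda>i. (\<Sum>k\<in>UNIV. of_int (b k) * c k) * d i - (\<Sum>k\<in>UNIV. of_int (a k) * d k) * c i)"
proof -
  let ?r = "\<Sum>k\<in>UNIV. of_int (b k) * c k" and ?s = "\<Sum>k\<in>UNIV. of_int (a k) * d k"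
  have flat: "flat_coeff (\<lambda>i. ?r * d i - ?s * c i) k = ?r * flat_coeff d k - ?s * flat_coeff c k" for k
    by (cases k) (simp_all add: flat_coeff_def)
  have "flat_coeff (\<lambda>i. ?r * d i - ?s * c i) k * of_int (a l + b l) =
      flat_coeff (\<lambda>i. ?r * d i - ?s * c i) l * of_int (a k + b k)" for k l
  proof -
    have "?r * (flat_coeff d k * of_int (a l) - flat_coeff d l * of_int (a k)) =
        ?s * (flat_coeff c k * of_int (b l) - flat_coeff c l * of_int (b k))"
    proof (cases "(\<forall>k. a k = 0) \<or> (\<forall>k. b k = 0)")
      case True
      then show ?thesis
        by auto
    next
      case False
      then obtain p q where "a p \<noteq> 0" "b q \<noteq> 0"
        by blast
      obtain r where r: "\<And>k. flat_coeff c k = r * of_int (a k)"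
      proof
        show "flat_coeff c k = flat_coeff c p / of_int (a p) * of_int (a k)" for k
          using a \<open>a p \<noteq> 0\<close> by (simp add: symplectic_coeff_def field_simps)
      qed
      obtain s where s: "\<And>k. flat_coeff d k = s * of_int (b k)"
      proof
        show "flat_coeff d k = flat_coeff d q / of_int (b q) * of_int (b k)" for k
          using b \<open>b q \<noteq> 0\<close> by (simp add: symplectic_coeff_def field_simps)
      qed
      let ?\<Omega> = "\<Sum>j\<in>UNIV. of_int (b (Inl j) * a (Inr j) - b (Inr j) * a (Inl j)) :: complex"
      have pairing: "(\<Sum>k\<in>UNIV. of_int (e k) * f k) = (\<Sum>j\<in>UNIV.
          of_int (e (Inl j)) * flat_coeff f (Inr j) - of_int (e (Inr j)) * flat_coeff f (Inl j))"
        for e :: "'n + 'n \<Rightarrow> int" and f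
        by (simp add: sum_UNIV_Plus flat_coeff_def)
      have "?r = r * ?\<Omega>"
        unfolding pairing r by (simp add: sum_distrib_left algebra_simps)
      moreover have "?s = - s * ?\<Omega>"
        unfolding pairing s sum_distrib_left by (intro sum.cong) (simp_all add: algebra_simps)
      ultimately show ?thesis
        unfolding r s by (simp add: algebra_simps)
    qed
    moreover have "flat_coeff c k * of_int (a l) = flat_coeff c l * of_int (a k)"
      "flat_coeff d k * of_int (b l) = flat_coeff d l * of_int (b k)"
      using a b by (simp_all add: symplectic_coeff_def)
    ultimately show ?thesis
      unfolding flat of_int_add by algebra
  qed
  then show ?thesis
    unfolding symplectic_coeff_def by blast
qed

lemma lie_bracket_sum:
  fixes V :: "'i \<Rightarrow> 'm::finite vfield" and W :: "'j \<Rightarrow> 'm vfield"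
  assumes "finite I" "finite J"
    and V: "\<And>i. i \<in> I \<Longrightarrow> algebraic_vfield coord_prod (V i)"
    and W: "\<And>j. j \<in> J \<Longrightarrow> algebraic_vfield coord_prod (W j)"
  shows "lie_bracket torus (\<lambda>x. \<Sum>i\<in>I. V i x) (\<lambda>x. \<Sum>j\<in>J. W j x) =
    (\<lambda>x. \<Sum>i\<in>I. \<Sum>j\<in>J. lie_bracket torus (V i) (W j) x)"
proof
  fix x :: "complex ^ 'm"
  show "lie_bracket torus (\<lambda>x. \<Sum>i\<in>I. V i x) (\<lambda>x. \<Sum>j\<in>J. W j x) x =
    (\<Sum>i\<in>I. \<Sum>j\<in>J. lie_bracket torus (V i) (W j) x)"
  proof (cases "x \<in> torus")
    case True
    have lV: "laurent (\<lambda>y. V i y $ k)" if "i \<in> I" for i k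
      using V[OF that] by (simp add: algebraic_vfield_iff_laurent)
    have lW: "laurent (\<lambda>y. W j y $ k)" if "j \<in> J" for j k
      using W[OF that] by (simp add: algebraic_vfield_iff_laurent)
    have 1: "dir_deriv (\<lambda>y. (\<Sum>j\<in>J. W j y) $ k) x (\<Sum>i\<in>I. V i x) =
        (\<Sum>i\<in>I. \<Sum>j\<in>J. dir_deriv (\<lambda>y. W j y $ k) x (V i x))" for k
      by (subst sum.swap)
        (simp add: dir_deriv_sum dir_deriv_direction_sum lW assms True)
    have 2: "dir_deriv (\<lambda>y. (\<Sum>i\<in>I. V i y) $ k) x (\<Sum>j\<in>J. W j x) =
        (\<Sum>i\<in>I. \<Sum>j\<in>J. dir_deriv (\<lambda>y. V i y $ k) x (W j x))" for k
      by (simp add: dir_deriv_sum dir_deriv_direction_sum lV assms True)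
    show ?thesis
      using True unfolding lie_bracket_def 1 2 by (simp add: vec_eq_iff sum_subtractf)
  qed (simp add: lie_bracket_def)
qed

lemma symplectic_algebra_bracket:
  assumes "V \<in> symplectic_algebra" "W \<in> symplectic_algebra"
  shows "lie_bracket torus V W \<in> symplectic_algebra"
proof -
  obtain S c
    where S: "finite S" "\<forall>a\<in>S. symplectic_coeff a (c a)"
      and V: "V = (\<lambda>x. \<Sum>a\<in>S. char_field a (c a) x)"
    by (rule symplectic_algebra_decomposition[OF assms(1)])
  obtain T d
    where T: "finite T" "\<forall>b\<in>T. symplectic_coeff b (d b)"
      and W: "W = (\<lambda>x. \<Sum>b\<in>T. char_field b (d b) x)"
    by (rule symplectic_algebra_decomposition[OF assms(2)])
  show ?thesis
    unfolding V W lie_bracket_sum[OF S(1) T(1) algebraic_char_field algebraic_char_field]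
      lie_bracket_char_field
    using S T by (intro symplectic_algebra_sum char_field_in_symplectic_algebra_iff[THEN iffD2]
        symplectic_coeff_bracket) auto
qed

section \<open>The logarithmic form is symplectic\<close>

lemma algebraic_log_symplectic_form: "algebraic_form2 coord_prod log_symplectic_form"
proof -
  have vs: "vector_space ((*s) :: complex \<Rightarrow> complex ^ ('a + 'a) \<Rightarrow> _)" "vector_space ((*) :: complex \<Rightarrow> _)"
    by (unfold_locales; simp add: vector_add_ldistrib vector_sadd_rdistrib algebra_simps)+
  have "laurent (\<lambda>x. log_symplectic_form x u v)" for u v :: "complex ^ ('a + 'a)"
  proof -
    have "laurent (\<lambda>y. \<Sum>j\<in>UNIV. (u $ Inl j * v $ Inr j - u $ Inr j * v $ Inl j) *
        (inverse (y $ Inl j) * inverse (y $ Inr j)))"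
      by (intro laurent_sum laurent_mult laurent_scale laurent_coord_inverse) simp
    then show ?thesis
      by (rule laurent_cong) (simp add: log_symplectic_form_def wedge_def dlog_coord_def field_simps
          diff_divide_distrib)
  qed
  moreover have "Vector_Spaces.linear (*s) (*) (\<lambda>v. log_symplectic_form x u v)"
    "Vector_Spaces.linear (*s) (*) (\<lambda>u. log_symplectic_form x u v)"
    for x u v :: "complex ^ ('a + 'a)"
    using vs unfolding Vector_Spaces.linear_iff
    by (auto simp: log_symplectic_form_add log_symplectic_form_scale
        log_symplectic_form_swap[of x u])
  moreover have "log_symplectic_form x u u = 0" for x u :: "complex ^ ('a + 'a)"
    by (simp add: log_symplectic_form_def wedge_def)
  ultimately show ?thesis
    unfolding algebraic_form2_def by (simp add: regular_iff_laurent)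
qed

text \<open>
  For each \<open>j\<close> the cyclic sum is a combination of two \<open>3 \<times> 3\<close> determinants, each with two equal
  rows.
\<close>

lemma closed_log_symplectic_form: "closed_form2 torus log_symplectic_form"
proof -
  have D: "dir_deriv (\<lambda>y. log_symplectic_form y v w) x u =
      (\<Sum>j\<in>UNIV. (v $ Inl j * w $ Inr j - w $ Inl j * v $ Inr j) *
         (1 / (x $ Inl j * x $ Inr j) * - (u $ Inl j / x $ Inl j + u $ Inr j / x $ Inr j)))"
    if x: "x \<in> torus" for x u v w :: "complex ^ ('a + 'a)"
  proof -
    \<comment> \<open>The exponent of \<open>1 / (z\<^sub>j w\<^sub>j)\<close>.\<close>
    let ?e = "\<lambda>j k. - of_bool (k = Inl j) + - of_bool (k = Inr j)"
    have char: "torus_char (?e j) y = 1 / (y $ Inl j * y $ Inr j)"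
      if "y \<in> torus" for y :: "complex ^ ('a + 'a)" and j
      unfolding torus_char_add[OF that] torus_char_inverse[OF that] torus_char_coord
      by (simp add: field_simps)
    have "log_symplectic_form y v w =
        (\<Sum>j\<in>UNIV. (v $ Inl j * w $ Inr j - w $ Inl j * v $ Inr j) * torus_char (?e j) y)"
      if "y \<in> torus" for y
      unfolding char[OF that]
      by (simp add: log_symplectic_form_def wedge_def dlog_coord_def diff_divide_distrib)
    from dir_deriv_char_sum[OF _ this x, of u]
    have "dir_deriv (\<lambda>y. log_symplectic_form y v w) x u =
        (\<Sum>j\<in>UNIV. (v $ Inl j * w $ Inr j - w $ Inl j * v $ Inr j) *
          (torus_char (?e j) x * (\<Sum>k\<in>UNIV. of_int (?e j k) * (u $ k / x $ k))))"
      by simp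
    moreover have "(\<Sum>k\<in>UNIV. of_int (?e j k) * (u $ k / x $ k)) =
        - (u $ Inl j / x $ Inl j + u $ Inr j / x $ Inr j)" for j
    proof -
      have "(\<Sum>k\<in>UNIV. of_int (?e j k) * (u $ k / x $ k)) =
        (\<Sum>k\<in>UNIV. - (if k = Inl j then u $ k / x $ k else 0) - (if k = Inr j then u $ k / x $ k else 0))"
        by (intro sum.cong) auto
      then show ?thesis
        by (simp add: sum_subtractf sum_negf)
    qed
    ultimately show ?thesis
      unfolding char[OF x] by simp
  qed
  show ?thesis
    unfolding closed_form2_def
  proof (intro ballI allI)
    fix x u v w :: "complex ^ ('a + 'a)"
    assume x: "x \<in> torus"
    show "dir_deriv (\<lambda>y. log_symplectic_form y v w) x u - dir_deriv (\<lambda>y. log_symplectic_form y u w) x v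
        + dir_deriv (\<lambda>y. log_symplectic_form y u v) x w = 0"
      unfolding D[OF x] sum_subtractf[symmetric] sum.distrib[symmetric]
      using torus_coord_nonzero[OF x] by (intro sum.neutral ballI) (simp add: field_simps)
  qed
qed

lemma nondegenerate_log_symplectic_form: "nondegenerate_form2 torus log_symplectic_form"
  unfolding nondegenerate_form2_def
proof (intro ballI allI impI)
  fix x u :: "complex ^ ('a + 'a)"
  assume x: "x \<in> torus" and u: "\<forall>v. log_symplectic_form x u v = 0"
  have "u $ k = 0" for k
  proof (cases k)
    case (Inl j)
    have "log_symplectic_form x u (axis (Inr j) 1) =
        (\<Sum>i\<in>UNIV. if i = j then u $ Inl i / (x $ Inl i * x $ Inr i) else 0)"
      unfolding log_symplectic_form_def by (intro sum.cong) (auto simp: wedge_def dlog_coord_def axis_def)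
    then show ?thesis
      using u torus_coord_nonzero[OF x] Inl by simp
  next
    case (Inr j)
    have "log_symplectic_form x u (axis (Inl j) 1) =
        (\<Sum>i\<in>UNIV. if i = j then - (u $ Inr i / (x $ Inl i * x $ Inr i)) else 0)"
      unfolding log_symplectic_form_def by (intro sum.cong) (auto simp: wedge_def dlog_coord_def axis_def)
    then show ?thesis
      using u torus_coord_nonzero[OF x] Inr by simp
  qed
  then show "u = 0"
    by (simp add: vec_eq_iff)
qed

section \<open>The density property\<close>

lemma generated_lie_algebra_sum:
  "finite I \<Longrightarrow> (\<And>i. i \<in> I \<Longrightarrow> V i \<in> generated_lie_algebra X G) \<Longrightarrow>
    (\<lambda>x. \<Sum>i\<in>I. V i x) \<in> generated_lie_algebra X G"
  by (induction I rule: finite_induct)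
    (auto intro: generated_lie_algebra.zero generated_lie_algebra.add)

theorem theorem3p4:
  "algebraic_symplectic_density_property
     (coord_prod :: complex ^ ('n::finite + 'n) \<Rightarrow> complex)
     (log_symplectic_form :: ('n + 'n) form2)"
proof -
  let ?G = "{V :: ('n + 'n) vfield. algebraic_vfield coord_prod V \<and>
      symplectic_vfield torus log_symplectic_form V \<and> complete_vfield torus V}"
  have "generated_lie_algebra torus ?G = symplectic_algebra"
  proof (intro equalityI subsetI)
    fix V assume "V \<in> generated_lie_algebra torus ?G"
    then show "V \<in> symplectic_algebra"
      by induction
        (auto simp: symplectic_algebra_def[symmetric]
          intro: symplectic_algebra_zero symplectic_algebra_add symplectic_algebra_scale
          symplectic_algebra_bracket, simp add: symplectic_algebra_def)
  next
    fix V :: "('n + 'n) vfield" assume "V \<in> symplectic_algebra"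
    then obtain S c where S: "finite S" "\<forall>a\<in>S. symplectic_coeff a (c a)"
      and V: "V = (\<lambda>x. \<Sum>a\<in>S. char_field a (c a) x)"
      by (elim symplectic_algebra_decomposition) blast
    have "char_field a (c a) \<in> generated_lie_algebra torus ?G" if "a \<in> S" for a
      using S(2) that
      by (intro generated_lie_algebra.generator)
        (simp add: algebraic_char_field symplectic_char_field_iff complete_char_field
          symplectic_coeff_annihilates)
    then show "V \<in> generated_lie_algebra torus ?G"
      unfolding V by (intro generated_lie_algebra_sum S)
  qed
  then show ?thesis
    unfolding algebraic_symplectic_density_property_def algebraic_symplectic_form_def
    by (simp add: polynomial_coord_prod algebraic_log_symplectic_form closed_log_symplectic_form
        nondegenerate_log_symplectic_form symplectic_algebra_def)
qed

end
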